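(* There exists an absolute real constant $h\in[1.280,1.281)$ (i.e. $h=1.280\ldots$) such that for every $f\in\mathcal{S}_b$ with Taylor expansion $f(z)=z+a_2z^2+a_3z^3+\cdots$ in $\mathbb{D}$, the second Hankel determinant $H_{2,2}(f)=a_2a_4-a_3^2$ satisfies $$|H_{2,2}(f)|\le h.$$
   Context: Let $\mathbb{D}=\{z\in\mathbb{C}:|z|<1\}$. $\mathcal{S}$ is the class of functions $f$ that are analytic and univalent (injective) in $\mathbb{D}$ with expansion $f(z)=z+a_2z^2+a_3z^3+\cdots$. $\mathcal{S}_b\subset\mathcal{S}$ is the class of (normalized) bi-univalent functions: those $f\in\mathcal{S}$ whose inverse function $f^{-1}$ is also univalent in $\mathbb{D}$, meaning that the inverse of $f$ near the origin (with $f^{-1}(0)=0$) extends to an analytic univalent function on $\mathbb{D}$. (For example $z$, $z/(1-z)$ and $\frac12\log\frac{1+z}{1-z}$ belong to $\mathcal{S}_b$.) *)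

theory Defs
  imports "HOL-Complex_Analysis.Complex_Analysis"
begin

abbreviation unit_disc :: "complex set" where
  "unit_disc \<equiv> ball 0 1"

(* Functions are total in HOL; only the values on the unit disc are constrained. *)
definition class_S :: "(complex \<Rightarrow> complex) set" where
  "class_S = {f. f holomorphic_on unit_disc \<and> inj_on f unit_disc \<and> f 0 = 0 \<and> deriv f 0 = 1}"

(* The inverse of f is defined on the image of the unit disc, which is a neighbourhood of 0 but
   need not contain the whole unit disc; g extends the germ of that inverse at 0. *)
definition class_Sb :: "(complex \<Rightarrow> complex) set" where
  "class_Sb = {f \<in> class_S. \<exists>g. g holomorphic_on unit_disc \<and> inj_on g unit_disc \<and>
     (\<forall>\<^sub>F w in nhds 0. g w = the_inv_into unit_disc f w)}"

abbreviation taylor_coeff :: "(complex \<Rightarrow> complex) \<Rightarrow> nat \<Rightarrow> complex" where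
  "taylor_coeff f n \<equiv> fps_nth (fps_expansion f 0) n"

definition hankel_2_2 :: "(complex \<Rightarrow> complex) \<Rightarrow> complex" where
  "hankel_2_2 f = taylor_coeff f 2 * taylor_coeff f 4 - (taylor_coeff f 3)\<^sup>2"

end

theory Submission
  imports Defs
begin

unbundle no Formal_Power_Series.fps_syntax

text \<open>
  Write \<open>p = a\<^sub>2\<^sup>2 - a\<^sub>3\<close> and \<open>q = - a\<^sub>4 + 2 a\<^sub>2 a\<^sub>3 - a\<^sub>2\<^sup>3\<close> for the coefficients of \<open>z\<close> and \<open>z\<^sup>2\<close> in the
  Laurent expansion of \<open>1 / f\<close>. Then \<open>H = - a\<^sub>2 q - p\<^sup>2\<close>, and Gronwall's area theorem gives
  \<open>|p|\<^sup>2 + 2 |q|\<^sup>2 \<le> 1\<close>. The area theorem for \<open>1 / sqrt (f (z\<^sup>2))\<close>, applied to \<open>f\<close> and to its inverse and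
  added up with the parallelogram law, yields \<open>s + 3/4 s\<^sup>2 + 3/4 |p|\<^sup>2 \<le> 1\<close> for \<open>s = |a\<^sub>2 / 2|\<^sup>2\<close>.
  By the arithmetic-geometric mean inequality \<open>|H|\<close> is at most both \<open>1 + s/2\<close> and
  \<open>7/6 + s/3 - s\<^sup>2/2\<close>, the smaller of which is below \<open>1.28\<close> for every \<open>s\<close>.
\<close>

section \<open>Area of holomorphic images and of ellipses\<close>

lemma image_vector_cbox:
  "(\<lambda>p. vector [fst p, snd p] :: real^2) ` cbox (a, c) (b, d) = cbox (vector [a, c]) (vector [b, d])"
proof (intro set_eqI iffI)
  fix v :: "real^2" assume "v \<in> cbox (vector [a, c]) (vector [b, d])"
  then have "(v $ 1, v $ 2) \<in> cbox (a, c) (b, d)" "v = vector [fst (v $ 1, v $ 2), snd (v $ 1, v $ 2)]"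
    by (auto simp: cbox_Pair_eq mem_box_cart forall_2 vec_eq_iff)
  then show "v \<in> (\<lambda>p. vector [fst p, snd p]) ` cbox (a, c) (b, d)" by blast
qed (auto simp: mem_box_cart forall_2 cbox_Pair_eq)

text \<open>The area formula with \<open>det\<close> is applied on \<open>real^2\<close>, Fubini's
  theorem on \<open>real \<times> real\<close>. The coordinate map between the two preserves the
  volume of boxes, so integrals transfer with factor 1.\<close>

lemma integral_cbox_vector2:
  fixes f :: "real^2 \<Rightarrow> real"
  assumes cont: "continuous_on (cbox (vector [a, c]) (vector [b, d])) f"
  shows "integral (cbox (vector [a, c]) (vector [b, d])) f =
    integral {a..b} (\<lambda>x. integral {c..d} (\<lambda>y. f (vector [x, y])))"
proof -
  let ?g = "\<lambda>p::real \<times> real. vector [fst p, snd p] :: real^2"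
  let ?h = "\<lambda>v::real^2. (v $ 1, v $ 2)"
  have hg: "?h (?g x) = x" for x by simp
  have gh: "?g (?h x) = x" for x by (auto simp: vec_eq_iff forall_2)
  have g_box: "?g ` cbox u v = cbox (?g u) (?g v)" for u v
    using image_vector_cbox[of "fst u" "snd u" "fst v" "snd v"] by simp
  have h_box: "?h ` cbox u v = cbox (?h u) (?h v)" for u v
  proof -
    have "?h ` cbox u v = ?h ` ?g ` cbox (?h u) (?h v)" by (simp only: g_box gh)
    then show ?thesis by (simp only: image_image hg image_ident)
  qed
  have linear_g: "linear ?g"
    by (rule linearI) (auto simp: vec_eq_iff forall_2)
  have cont_g: "continuous (at x) ?g" for x
    using linear_g linear_continuous_at linear_conv_bounded_linear by blast
  have content_g: "measure lborel (?g ` cbox u v) = 1 * measure lborel (cbox u v)" for u v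
  proof (cases "cbox u v = {}")
    case False
    obtain u1 u2 v1 v2 where uv: "u = (u1, u2)" "v = (v1, v2)" by (cases u, cases v) auto
    have le: "u1 \<le> v1" "u2 \<le> v2" using False by (auto simp: uv cbox_Pair_eq)
    have "cbox (?g u) (?g v) \<noteq> {}" using False by (simp flip: g_box)
    then have "measure lborel (cbox (?g u) (?g v)) = (v1 - u1) * (v2 - u2)"
      unfolding content_cbox_cart[OF \<open>cbox (?g u) (?g v) \<noteq> {}\<close>] UNIV_2 by (simp add: uv)
    with le show ?thesis
      unfolding g_box by (simp add: uv content_Pair)
  qed simp
  have "f integrable_on cbox (vector [a, c]) (vector [b, d])"
    using cont integrable_continuous by blast
  then have "(f has_integral integral (cbox (vector [a, c]) (vector [b, d])) f)
      (cbox (vector [a, c]) (vector [b, d]))" by blast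
  from has_integral_twiddle[OF zero_less_one hg gh cont_g _ _ content_g this]
  have "((\<lambda>p. f (?g p)) has_integral integral (cbox (vector [a, c]) (vector [b, d])) f)
      (?h ` cbox (vector [a, c]) (vector [b, d]))"
    using g_box h_box by auto
  then have "integral (cbox (vector [a, c]) (vector [b, d])) f =
      integral (cbox (a, c) (b, d)) (\<lambda>p. f (?g p))"
    by (simp add: h_box integral_unique)
  also have "\<dots> = integral (cbox a b) (\<lambda>x. integral (cbox c d) (\<lambda>y. f (?g (x, y))))"
  proof (rule integral_prod_continuous)
    show "continuous_on (cbox (a, c) (b, d)) (\<lambda>p. f (?g p))"
    proof (rule continuous_on_compose2[OF cont])
      show "continuous_on (cbox (a, c) (b, d)) ?g"
        using cont_g continuous_at_imp_continuous_on by blast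
    qed (simp only: image_vector_cbox order_refl)
  qed
  finally show ?thesis by simp
qed

text \<open>\<open>K\<close> is the map \<open>u + c * cnj u\<close> in real coordinates. Its
  determinant is 1 minus the squared norm of \<open>c\<close>, so it does not increase area as long
  as \<open>norm c \<le> 1\<close>.\<close>

lemma measure_ellipse_le:
  fixes c :: complex
  assumes c: "norm c \<le> 1" and R: "R \<ge> 0"
  defines "K \<equiv> (\<lambda>v::real^2. vector [v $ 1 + (Re c * v $ 1 + Im c * v $ 2),
    v $ 2 + (Im c * v $ 1 - Re c * v $ 2)] :: real^2)"
  shows "(\<lambda>v. v0 + K v) ` cball 0 R \<in> lmeasurable"
    "measure lebesgue ((\<lambda>v. v0 + K v) ` cball 0 R) \<le> pi * R\<^sup>2"
proof -
  have lin: "linear K"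
    by (rule linearI) (auto simp: K_def vec_eq_iff forall_2 algebra_simps)
  have "(Re c)\<^sup>2 + (Im c)\<^sup>2 = (norm c)\<^sup>2" by (simp add: cmod_power2)
  moreover have "(norm c)\<^sup>2 \<le> 1" using c by (simp add: power_le_one)
  ultimately have "\<bar>1 - ((Re c)\<^sup>2 + (Im c)\<^sup>2)\<bar> \<le> 1" by (simp add: abs_le_iff)
  moreover have "det (matrix K) = 1 - ((Re c)\<^sup>2 + (Im c)\<^sup>2)"
    by (simp add: det_2 matrix_def K_def axis_def algebra_simps power2_eq_square)
  ultimately have det: "\<bar>det (matrix K)\<bar> \<le> 1" by simp
  have "measure lebesgue (K ` cball 0 R) = \<bar>det (matrix K)\<bar> * measure lebesgue (cball 0 R :: (real^2) set)"
    by (rule measure_linear_image[OF lin]) simp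
  also have "\<dots> \<le> 1 * measure lebesgue (cball 0 R :: (real^2) set)"
    by (rule mult_right_mono[OF det]) simp
  also have "\<dots> = pi * R\<^sup>2" using R by (simp add: content_cball unit_ball_vol_2)
  finally have *: "measure lebesgue (K ` cball 0 R) \<le> pi * R\<^sup>2" .
  have eq: "(\<lambda>v. v0 + K v) ` cball 0 R = (+) v0 ` K ` cball 0 R" by (simp add: image_image)
  show "(\<lambda>v. v0 + K v) ` cball 0 R \<in> lmeasurable"
    unfolding eq by (intro measurable_translation measurable_linear_image lin) simp
  show "measure lebesgue ((\<lambda>v. v0 + K v) ` cball 0 R) \<le> pi * R\<^sup>2"
    unfolding eq measure_translation by (rule *)
qed

text \<open>The squared norm of the derivative is the Jacobian, so the integral is the area of the
  image, and the image lies in an ellipse. Injectivity and the inclusion are asked for on the open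
  rectangle only: \<open>\<Phi>\<close> will be periodic with the height of the rectangle as period,
  and the boundary is a null set.\<close>

lemma integral_norm_deriv_le_ellipse:
  fixes \<Phi> :: "complex \<Rightarrow> complex" and a b c d R :: real
  defines "Rect \<equiv> {z. a \<le> Re z \<and> Re z \<le> b \<and> c \<le> Im z \<and> Im z \<le> d}"
  assumes der: "\<And>z. z \<in> Rect \<Longrightarrow> (\<Phi> has_field_derivative \<Phi>' z) (at z)"
    and cont: "continuous_on Rect \<Phi>'"
    and inj: "inj_on \<Phi> {z. a < Re z \<and> Re z < b \<and> c < Im z \<and> Im z < d}"
    and image: "\<And>z. a < Re z \<Longrightarrow> Re z < b \<Longrightarrow> c < Im z \<Longrightarrow> Im z < d \<Longrightarrow>
      \<exists>u. norm u \<le> R \<and> \<Phi> z = w0 + (u + k * cnj u)"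
    and k: "norm k \<le> 1" and R: "R \<ge> 0"
  shows "integral {a..b} (\<lambda>x. integral {c..d} (\<lambda>y. (norm (\<Phi>' (Complex x y)))\<^sup>2)) \<le> pi * R\<^sup>2"
proof -
  define C where "C = (\<lambda>v::real^2. Complex (v $ 1) (v $ 2))"
  define T where "T = (\<lambda>z. vector [Re z, Im z] :: real^2)"
  have CT: "C (T z) = z" and TC: "T (C v) = v" for z v
    by (auto simp: C_def T_def vec_eq_iff forall_2)
  have lin_C: "linear C"
    by (rule linearI) (auto simp: C_def complex_eq_iff)
  have lin_T: "linear T"
    by (rule linearI) (auto simp: T_def vec_eq_iff forall_2)
  have der_C: "(C has_derivative C) F" and der_T: "(T has_derivative T) F'" for F F'
    using lin_C lin_T linear_imp_has_derivative by blast+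
  define g where "g = (\<lambda>v. T (\<Phi> (C v)))"
  define g' where "g' = (\<lambda>v h. T (\<Phi>' (C v) * C h))"
  define S where "S = (box (vector [a, c]) (vector [b, d]) :: (real^2) set)"
  have S_iff: "v \<in> S \<longleftrightarrow> a < Re (C v) \<and> Re (C v) < b \<and> c < Im (C v) \<and> Im (C v) < d" for v
    by (auto simp: S_def C_def mem_box_cart forall_2)
  have C_cbox: "C v \<in> Rect" if "v \<in> cbox (vector [a, c]) (vector [b, d])" for v
    using that by (auto simp: Rect_def C_def mem_box_cart forall_2)
  have der_g: "(g has_derivative g' v) (at v within S)" if "v \<in> S" for v
  proof -
    have "C v \<in> Rect" using that by (auto simp: S_iff Rect_def)
    then have "(\<Phi> has_derivative (\<lambda>h. \<Phi>' (C v) * h)) (at (C v))"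
      using der by (simp add: has_field_derivative_def)
    from has_derivative_compose[OF has_derivative_compose[OF der_C this] der_T]
    show ?thesis by (simp add: g_def g'_def)
  qed
  have inj_g: "inj_on g S"
  proof (rule inj_onI)
    fix v w assume vw: "v \<in> S" "w \<in> S" "g v = g w"
    then have "\<Phi> (C v) = \<Phi> (C w)" unfolding g_def by (metis CT)
    then have "C v = C w" by (rule inj_onD[OF inj]) (use vw S_iff in auto)
    then show "v = w" by (metis TC)
  qed
  \<comment> \<open>By the Cauchy-Riemann equations the derivative is multiplication by a complex
    number, whose real determinant is the square of its modulus.\<close>
  have det: "\<bar>det (matrix (g' v))\<bar> = (norm (\<Phi>' (C v)))\<^sup>2" for v
    unfolding cmod_power2
    by (simp add: det_2 matrix_def g'_def C_def T_def axis_def algebra_simps power2_eq_square)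
  have cont_det: "continuous_on (cbox (vector [a, c]) (vector [b, d])) (\<lambda>v. (norm (\<Phi>' (C v)))\<^sup>2)"
  proof (intro continuous_intros continuous_on_compose2[OF cont])
    show "continuous_on (cbox (vector [a, c]) (vector [b, d])) C"
      using lin_C linear_continuous_on linear_conv_bounded_linear by blast
  qed (use C_cbox in auto)
  have int_S: "(\<lambda>v. \<bar>det (matrix (g' v))\<bar>) integrable_on S"
    unfolding det S_def integrable_on_open_interval
    using cont_det integrable_continuous by blast
  have S_sets: "S \<in> sets lebesgue" by (simp add: S_def)
  let ?K = "\<lambda>v::real^2. vector [v $ 1 + (Re k * v $ 1 + Im k * v $ 2),
    v $ 2 + (Im k * v $ 1 - Re k * v $ 2)] :: real^2"
  have "g ` S \<subseteq> (\<lambda>v. T w0 + ?K v) ` cball 0 R"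
  proof
    fix y assume "y \<in> g ` S"
    then obtain v where v: "v \<in> S" "y = g v" by blast
    with image[of "C v"] S_iff obtain u where u: "norm u \<le> R" "\<Phi> (C v) = w0 + (u + k * cnj u)" by blast
    have "norm (T u) = norm u"
      by (simp add: T_def norm_vec_def L2_set_def sum_2 cmod_def)
    moreover have "y = T w0 + ?K (T u)"
      unfolding v(2) g_def u(2) by (simp add: T_def vec_eq_iff forall_2)
    ultimately show "y \<in> (\<lambda>v. T w0 + ?K v) ` cball 0 R"
      using u(1) by (intro image_eqI[of _ _ "T u"]) auto
  qed
  then have "measure lebesgue (g ` S) \<le> measure lebesgue ((\<lambda>v. T w0 + ?K v) ` cball 0 R)"
    using measure_ellipse_le(1)[OF k R, of "T w0"]
      measurable_differentiable_image_eq[OF S_sets der_g inj_g] int_S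
    by (intro measure_mono_fmeasurable) auto
  also have "\<dots> \<le> pi * R\<^sup>2" by (rule measure_ellipse_le(2)[OF k R])
  also have "measure lebesgue (g ` S) = integral S (\<lambda>v. (norm (\<Phi>' (C v)))\<^sup>2)"
    using measure_differentiable_image_eq[OF S_sets der_g inj_g int_S] unfolding det .
  also have "\<dots> = integral (cbox (vector [a, c]) (vector [b, d])) (\<lambda>v. (norm (\<Phi>' (C v)))\<^sup>2)"
    unfolding S_def by (rule integral_open_interval)
  also have "\<dots> = integral {a..b} (\<lambda>x. integral {c..d} (\<lambda>y. (norm (\<Phi>' (Complex x y)))\<^sup>2))"
    by (subst integral_cbox_vector2[OF cont_det]) (simp add: C_def)
  finally show ?thesis .
qed

section \<open>Bessel inequality on circles\<close>

text \<open>This is Cauchy's formula for the \<open>n\<close>-th derivative on the circle of radius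
  \<open>r\<close>, read as a Fourier integral.\<close>

lemma has_integral_fourier_coeff:
  fixes f :: "complex \<Rightarrow> complex"
  assumes holo: "f holomorphic_on unit_disc" and exp: "f has_fps_expansion A"
    and r: "0 < r" "r < 1"
  shows "((\<lambda>t. f (of_real r * cis t) * cis (- (real n * t))) has_integral
    2 * pi * (fps_nth A n * of_real r ^ n)) {0..2 * pi}"
proof -
  have cont: "continuous_on (cball 0 r) f" and holo': "f holomorphic_on ball 0 r"
    using holo r by (auto intro!: holomorphic_on_imp_continuous_on elim!: holomorphic_on_subset)
  have "((\<lambda>u. f u / (u - 0) ^ Suc n) has_contour_integral (2 * pi * \<i>) / fact n * (deriv ^^ n) f 0)
      (circlepath 0 r)"
    by (rule Cauchy_has_contour_integral_higher_derivative_circlepath[OF cont holo']) (use r in auto)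
  then have "((\<lambda>t. f (of_real r * cis t) / (of_real r * cis t) ^ Suc n * of_real r * \<i> * cis t)
      has_integral (2 * pi * \<i>) * fps_nth A n) {0..2 * pi}"
    unfolding circlepath_def fps_nth_fps_expansion[OF exp]
    by (subst (asm) has_contour_integral_part_circlepath_iff) auto
  \<comment> \<open>The parametrised integrand carries \<open>\<i>\<close> over the
    \<open>n\<close>-th power of \<open>of_real r * cis t\<close>; this factor leaves only
    \<open>cis (- (real n * t))\<close>.\<close>
  from has_integral_mult_right[OF this, of "of_real r ^ n / \<i>"]
  have "((\<lambda>t. of_real r ^ n / \<i> * (f (of_real r * cis t) / (of_real r * cis t) ^ Suc n * of_real r * \<i> * cis t))
      has_integral 2 * pi * (fps_nth A n * of_real r ^ n)) {0..2 * pi}"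
    by (simp add: mult_ac)
  moreover have "of_real r ^ n / \<i> * (f (of_real r * cis t) / (of_real r * cis t) ^ Suc n * of_real r * \<i> * cis t)
      = f (of_real r * cis t) * cis (- (real n * t))" for t
  proof -
    have "cis (- (real n * t)) = inverse (cis t ^ n)" by (simp only: Complex.DeMoivre cis_inverse)
    then show ?thesis using r by (simp add: power_mult_distrib field_simps)
  qed
  ultimately show ?thesis by simp
qed

text \<open>The inner product with a polynomial on a circle, by linearity. Bessel's inequality needs
  it twice: for the function and for its own Taylor polynomial.\<close>

lemma has_integral_cnj_trig_poly:
  fixes f :: "complex \<Rightarrow> complex"
  assumes holo: "f holomorphic_on unit_disc" and exp: "f has_fps_expansion A"
    and r: "0 < r" "r < 1"
  shows "((\<lambda>t. f (of_real r * cis t) * cnj (\<Sum>n\<le>N. c n * (of_real r * cis t) ^ n)) has_integral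
    2 * pi * (\<Sum>n\<le>N. fps_nth A n * cnj (c n) * of_real r ^ (2 * n))) {0..2 * pi}"
proof -
  have "((\<lambda>t. \<Sum>n\<le>N. cnj (c n) * of_real r ^ n * (f (of_real r * cis t) * cis (- (real n * t))))
      has_integral (\<Sum>n\<le>N. cnj (c n) * of_real r ^ n * (2 * pi * (fps_nth A n * of_real r ^ n)))) {0..2 * pi}"
    by (intro has_integral_sum has_integral_mult_right has_integral_fourier_coeff assms) simp
  moreover have "(\<Sum>n\<le>N. cnj (c n) * of_real r ^ n * (f (of_real r * cis t) * cis (- (real n * t)))) =
      f (of_real r * cis t) * cnj (\<Sum>n\<le>N. c n * (of_real r * cis t) ^ n)" for t
    by (simp add: sum_distrib_left power_mult_distrib Complex.DeMoivre cis_cnj mult_ac)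
  moreover have "(\<Sum>n\<le>N. cnj (c n) * of_real r ^ n * (2 * pi * (fps_nth A n * of_real r ^ n))) =
      2 * pi * (\<Sum>n\<le>N. fps_nth A n * cnj (c n) * of_real r ^ (2 * n))"
    by (simp add: sum_distrib_left power_mult power2_eq_square power_mult_distrib mult_ac)
  ultimately show ?thesis by simp
qed

text \<open>For the Taylor polynomial \<open>?P\<close> of degree at most \<open>N\<close>, the
  cross term and the square of \<open>?P\<close> both integrate to \<open>?S\<close>. Integrating
  the squared norm of \<open>?u t - ?p t\<close> therefore gives the integral of the squared norm of
  \<open>f\<close> minus \<open>?S\<close>, which is nonnegative. No convergence of the series is
  involved.\<close>

lemma bessel_circle:
  fixes f :: "complex \<Rightarrow> complex"
  assumes holo: "f holomorphic_on unit_disc" and exp: "f has_fps_expansion A"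
    and r: "0 < r" "r < 1"
  shows "2 * pi * (\<Sum>n\<le>N. (norm (fps_nth A n))\<^sup>2 * r ^ (2 * n)) \<le>
    integral {0..2 * pi} (\<lambda>t. (norm (f (of_real r * cis t)))\<^sup>2)"
proof -
  let ?P = "\<lambda>z. \<Sum>n\<le>N. fps_nth A n * z ^ n"
  let ?u = "\<lambda>t. f (of_real r * cis t)" and ?p = "\<lambda>t. ?P (of_real r * cis t)"
  let ?S = "2 * pi * (\<Sum>n\<le>N. (norm (fps_nth A n))\<^sup>2 * r ^ (2 * n))"
  have P_exp: "?P has_fps_expansion (\<Sum>n\<le>N. fps_const (fps_nth A n) * fps_X ^ n)"
    by (intro fps_expansion_intros)
  have P_nth: "fps_nth (\<Sum>n\<le>N. fps_const (fps_nth A n) * fps_X ^ n) k = fps_nth A k" if "k \<le> N" for k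
    using that by (simp add: fps_sum_nth if_distrib cong: if_cong)
  have S: "2 * pi * (\<Sum>n\<le>N. fps_nth A n * cnj (fps_nth A n) * of_real r ^ (2 * n)) = complex_of_real ?S"
    by (simp add: complex_norm_square[symmetric])
  have up: "((\<lambda>t. ?u t * cnj (?p t)) has_integral complex_of_real ?S) {0..2 * pi}"
    using has_integral_cnj_trig_poly[OF holo exp r, of "fps_nth A" N] unfolding S .
  have "?P holomorphic_on unit_disc" by (intro holomorphic_intros)
  from has_integral_cnj_trig_poly[OF this P_exp r, of "fps_nth A" N]
  moreover have "(\<Sum>n\<le>N. fps_nth (\<Sum>n\<le>N. fps_const (fps_nth A n) * fps_X ^ n) n * cnj (fps_nth A n) * of_real r ^ (2 * n)) =
      (\<Sum>n\<le>N. fps_nth A n * cnj (fps_nth A n) * of_real r ^ (2 * n))"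
    by (intro sum.cong refl) (simp add: P_nth)
  ultimately have pp: "((\<lambda>t. ?p t * cnj (?p t)) has_integral complex_of_real ?S) {0..2 * pi}"
    by (simp only: S)
  have cont: "continuous_on {0..2 * pi} ?u"
    by (intro continuous_intros continuous_on_compose2[OF holomorphic_on_imp_continuous_on[OF holo]])
       (use r in \<open>auto simp: norm_mult\<close>)
  have "((\<lambda>t. (norm (?u t))\<^sup>2) has_integral integral {0..2 * pi} (\<lambda>t. (norm (?u t))\<^sup>2)) {0..2 * pi}"
    by (intro integrable_integral integrable_continuous_interval continuous_intros cont)
  from has_integral_add[OF has_integral_diff[OF this
      has_integral_mult_right[OF has_integral_Re[OF up], of 2]] has_integral_Re[OF pp]]
  have "((\<lambda>t. (norm (?u t))\<^sup>2 - 2 * Re (?u t * cnj (?p t)) + Re (?p t * cnj (?p t))) has_integral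
      integral {0..2 * pi} (\<lambda>t. (norm (?u t))\<^sup>2) - 2 * ?S + ?S) {0..2 * pi}"
    by simp
  moreover have "(norm (?u t))\<^sup>2 - 2 * Re (?u t * cnj (?p t)) + Re (?p t * cnj (?p t)) = (norm (?u t - ?p t))\<^sup>2" for t
    unfolding cmod_power2 by (simp only: minus_complex.simps times_complex.simps cnj.simps)
      (simp add: algebra_simps power2_eq_square)
  ultimately have "((\<lambda>t. (norm (?u t - ?p t))\<^sup>2) has_integral
      integral {0..2 * pi} (\<lambda>t. (norm (?u t))\<^sup>2) - 2 * ?S + ?S) {0..2 * pi}"
    by simp
  then have "0 \<le> integral {0..2 * pi} (\<lambda>t. (norm (?u t))\<^sup>2) - 2 * ?S + ?S"
    by (rule has_integral_nonneg) simp
  then show ?thesis by simp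
qed

section \<open>Images of punctured discs\<close>

lemma has_fps_expansion_factor_power:
  fixes g :: "complex \<Rightarrow> complex"
  assumes exp: "g has_fps_expansion G" and zero: "\<And>i. i < n \<Longrightarrow> fps_nth G i = 0" and "n > 0"
  obtains q Q where "q has_fps_expansion Q" "\<And>z. g z = z ^ n * q z"
proof -
  have "g 0 = 0" using has_fps_expansion_imp_0_eq_fps_nth_0[OF exp] zero[OF \<open>n > 0\<close>] by simp
  then have eq: "g z = z ^ n * (if z = 0 then fps_nth G n else g z / z ^ n)" for z
    using \<open>n > 0\<close> by simp
  have "(\<lambda>z. if z = 0 then fps_nth G n else g z / z ^ n) has_fps_expansion fps_shift n G"
  \<comment> \<open>Since \<open>subdegree 0 = 0 < n\<close>, the shift rule does not cover the zero
    series; there \<open>g\<close> vanishes near 0 and so does the quotient.\<close>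
  proof (cases "G = 0")
    case True
    then show ?thesis
      using exp by (auto simp: has_fps_expansion_def elim!: eventually_mono)
  next
    case False
    then have "n \<le> subdegree G" using zero by (intro subdegree_geI) auto
    then show ?thesis by (intro has_fps_expansion_shift exp refl)
  qed
  then show ?thesis using eq by (rule that)
qed

text \<open>Order three is what the area estimate needs: after division by \<open>z\<close> the
  error on \<open>norm z = \<rho>\<close> is O(\<open>\<rho>^2\<close>), which changes the square of
  a radius close to \<open>1 / \<rho>\<close> by only O(\<open>\<rho>\<close>).\<close>

lemma fps_taylor_remainder3:
  fixes f :: "complex \<Rightarrow> complex"
  assumes exp: "f has_fps_expansion A"
  obtains M \<delta> where "\<delta> > 0" "M \<ge> 0" "\<And>z. norm z < \<delta> \<Longrightarrow>
    norm (f z - (fps_nth A 0 + fps_nth A 1 * z + fps_nth A 2 * z ^ 2)) \<le> M * norm z ^ 3"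
proof -
  let ?g = "\<lambda>z. f z - (fps_nth A 0 + fps_nth A 1 * z + fps_nth A 2 * z ^ 2)"
  define G where
    "G = A - (fps_const (fps_nth A 0) + fps_const (fps_nth A 1) * fps_X + fps_const (fps_nth A 2) * fps_X ^ 2)"
  have g_exp: "?g has_fps_expansion G"
    unfolding G_def by (intro fps_expansion_intros exp)
  have G_nth: "fps_nth G n = 0" if "n < 3" for n
  proof -
    from that consider "n = 0" | "n = 1" | "n = 2" by linarith
    then show ?thesis by cases (simp_all add: G_def fps_X_power_nth)
  qed
  obtain q Q where q: "q has_fps_expansion Q" and gq: "\<And>z. ?g z = z ^ 3 * q z"
    using has_fps_expansion_factor_power[OF g_exp, of 3] G_nth by (metis zero_less_numeral)
  have "isCont q 0" using has_fps_expansion_imp_continuous[OF q, of UNIV] by simp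
  then obtain \<delta> where \<delta>: "\<delta> > 0" "\<And>z. dist z 0 < \<delta> \<Longrightarrow> dist (q z) (q 0) < 1"
    unfolding continuous_at_eps_delta using zero_less_one by metis
  show ?thesis
  proof (rule that[OF \<delta>(1), of "norm (q 0) + 1"])
    fix z :: complex assume "norm z < \<delta>"
    then have "norm (q z - q 0) < 1" using \<delta>(2)[of z] by (simp add: dist_norm)
    then have "norm (q z) \<le> norm (q 0) + 1" using norm_triangle_sub[of "q z" "q 0"] by linarith
    then show "norm (?g z) \<le> (norm (q 0) + 1) * norm z ^ 3"
      unfolding gq norm_mult norm_power by (simp add: mult_ac mult_right_mono)
  qed simp
qed

text \<open>The punctured disc is not compact, but the equation \<open>w = \<psi> z / z\<close> can
  be cleared of its denominator: \<open>\<psi> z - z * w = 0\<close> is a closed condition on pairs,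
  it excludes \<open>z = 0\<close> by itself, and projecting along the compact factor
  \<open>cball 0 \<rho>\<close> keeps closedness.\<close>

lemma closed_image_laurent:
  fixes \<psi> :: "complex \<Rightarrow> complex"
  assumes cont: "continuous_on (cball 0 \<rho>) \<psi>" and "\<psi> 0 \<noteq> 0"
  shows "closed ((\<lambda>z. \<psi> z / z) ` (cball 0 \<rho> - {0}))"
proof -
  have "(\<lambda>z. \<psi> z / z) ` (cball 0 \<rho> - {0}) = {w. \<exists>z. z \<in> cball 0 \<rho> \<and>
      (z, w) \<in> {p \<in> cball 0 \<rho> \<times> UNIV. \<psi> (fst p) - fst p * snd p = 0}}"
  proof safe
    fix z w assume "z \<in> cball 0 \<rho>" "\<psi> (fst (z, w)) - fst (z, w) * snd (z, w) = 0"
    moreover from this have "z \<noteq> 0" using assms(2) by auto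
    ultimately show "w \<in> (\<lambda>z. \<psi> z / z) ` (cball 0 \<rho> - {0})"
      by (intro image_eqI[of _ _ z]) (auto simp: field_simps)
  qed auto
  also have "closed \<dots>"
  proof (rule closed_compact_projection)
    have "continuous_on (cball 0 \<rho> \<times> UNIV) (\<lambda>p. \<psi> (fst p) - fst p * snd p)"
      by (intro continuous_intros continuous_on_compose2[OF cont]) auto
    then have "closed ((cball 0 \<rho> \<times> UNIV) \<inter> (\<lambda>p. \<psi> (fst p) - fst p * snd p) -` {0})"
      by (intro continuous_closed_preimage closed_Times) auto
    then show "closed {p \<in> cball 0 \<rho> \<times> UNIV. \<psi> (fst p) - fst p * snd p = 0}"
      by (simp add: vimage_def Int_def)
  qed simp
  finally show ?thesis .
qed

text \<open>The images of the smaller punctured disc and of its complement are disjoint; outside \<open>K\<close> the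
  former is both open and closed, hence exhausts the connected set \<open>- K\<close>.\<close>
lemma laurent_image_subset_of_circle:
  fixes \<psi> :: "complex \<Rightarrow> complex"
  assumes holo: "\<psi> holomorphic_on unit_disc" and "\<psi> 0 \<noteq> 0"
    and inj: "inj_on (\<lambda>z. \<psi> z / z) (unit_disc - {0})"
    and \<rho>: "0 < \<rho>" "\<rho> < 1"
    and K: "compact K" "convex K"
    and circle: "\<And>z. norm z = \<rho> \<Longrightarrow> \<psi> z / z \<in> K"
    and z: "\<rho> < norm z" "norm z < 1"
  shows "\<psi> z / z \<in> K"
proof (rule ccontr)
  let ?F = "\<lambda>z. \<psi> z / z"
  assume notin: "?F z \<notin> K"
  let ?A = "?F ` (ball 0 \<rho> - {0})" and ?B = "- ?F ` (cball 0 \<rho> - {0})"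
  have cont: "continuous_on unit_disc \<psi>" by (rule holomorphic_on_imp_continuous_on[OF holo])
  have cont\<rho>: "continuous_on (cball 0 \<rho>) \<psi>"
    by (rule continuous_on_subset[OF cont]) (use \<rho> in auto)
  have "open ?A"
  proof (rule open_mapping_thm3)
    show "?F holomorphic_on ball 0 \<rho> - {0}"
      using \<rho> by (intro holomorphic_intros holomorphic_on_subset[OF holo]) auto
    show "inj_on ?F (ball 0 \<rho> - {0})" using \<rho> by (intro inj_on_subset[OF inj]) auto
  qed auto
  moreover have "open ?B"
    using closed_image_laurent[OF cont\<rho> \<open>\<psi> 0 \<noteq> 0\<close>] by (rule open_Compl)
  moreover have "connected (- K)"
    using K by (intro connected_complement_bounded_convex compact_imp_bounded) auto
  moreover have "?A \<inter> ?B \<inter> - K = {}" by force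
  moreover have "- K \<subseteq> ?A \<union> ?B"
  proof
    fix w assume w: "w \<in> - K"
    show "w \<in> ?A \<union> ?B"
    proof (cases "w \<in> ?F ` (cball 0 \<rho> - {0})")
      case True
      then obtain z where "z \<in> cball 0 \<rho> - {0}" "w = ?F z" by blast
      then have z: "norm z \<le> \<rho>" "z \<noteq> 0" "w = ?F z" by auto
      then have "norm z \<noteq> \<rho>" using circle w by auto
      then show ?thesis using z by auto
    qed auto
  qed
  ultimately have "?A \<inter> - K = {} \<or> ?B \<inter> - K = {}" by (meson connectedD)
  \<comment> \<open>The pole at 0 makes \<open>?F\<close> unbounded on the small punctured disc,
    whereas \<open>K\<close> is bounded.\<close>
  moreover have "?A \<inter> - K \<noteq> {}"
  proof -
    obtain B where B: "\<And>w. w \<in> K \<Longrightarrow> norm w \<le> B"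
      using compact_imp_bounded[OF K(1)] by (auto simp: bounded_iff)
    have "isCont \<psi> 0" using cont by (simp add: continuous_on_eq_continuous_at)
    then have "filterlim ?F at_infinity (at 0)"
      using \<open>\<psi> 0 \<noteq> 0\<close> by (intro filterlim_divide_at_infinity[of _ "\<psi> 0"])
        (auto simp: isCont_def filterlim_at eventually_at_filter)
    then have "eventually (\<lambda>z. norm (?F z) \<ge> max B 0 + 1) (at 0)"
      unfolding filterlim_at_infinity[OF order.refl] by (metis add_pos_nonneg add.commute max.cobounded2 zero_less_one)
    moreover have "eventually (\<lambda>z::complex. z \<in> ball 0 \<rho> - {0}) (at 0)"
      using eventually_at_in_open[of "ball 0 \<rho>" "0::complex"] \<rho> by simp
    ultimately have "eventually (\<lambda>z. norm (?F z) \<ge> max B 0 + 1 \<and> z \<in> ball 0 \<rho> - {0}) (at 0)"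
      by eventually_elim auto
    then obtain z where z: "norm (?F z) \<ge> max B 0 + 1" "z \<in> ball 0 \<rho> - {0}"
      using eventually_happens'[OF trivial_limit_at[of 0]] by (metis (no_types, lifting))
    then have "?F z \<notin> K" using B[of "?F z"] by auto
    then show ?thesis using z(2) by blast
  qed
  \<comment> \<open>So it is \<open>?B\<close> that misses \<open>- K\<close>. The value
    \<open>?F z\<close> then has a second preimage in the closed small disc, against
    injectivity.\<close>
  ultimately have "?F z \<in> ?F ` (cball 0 \<rho> - {0})" using notin by blast
  then obtain z' where "z' \<in> cball 0 \<rho> - {0}" "?F z = ?F z'" by blast
  then have z': "norm z' \<le> \<rho>" "z' \<noteq> 0" "?F z = ?F z'" by auto
  have "z = z'" by (rule inj_onD[OF inj z'(3)]) (use z z' \<rho> in auto)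
  then show False using z z' by simp
qed

text \<open>On \<open>norm z = \<rho>\<close> we have \<open>z = \<rho>\<^sup>2 * cnj (1 / z)\<close>, so up to \<open>O(\<rho>\<^sup>2)\<close> the map \<open>1 / z + b\<^sub>0 + b\<^sub>1 z\<close> is
  real-affine in \<open>u = 1 / z\<close>. A disc instead of the ellipse would lose a term \<open>2 * norm b\<^sub>1\<close> in the area.\<close>
lemma laurent_image_subset_ellipse:
  fixes \<psi> :: "complex \<Rightarrow> complex"
  assumes holo: "\<psi> holomorphic_on unit_disc" and exp: "\<psi> has_fps_expansion A" and A0: "fps_nth A 0 = 1"
    and inj: "inj_on (\<lambda>z. \<psi> z / z) (unit_disc - {0})"
  obtains M \<delta> where "\<delta> > 0" "M \<ge> 0"
    "\<And>\<rho>. 0 < \<rho> \<Longrightarrow> \<rho> < \<delta> \<Longrightarrow> norm (of_real \<rho> ^ 2 * fps_nth A 2) \<le> 1 \<and>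
      (\<forall>z. \<rho> < norm z \<longrightarrow> norm z < 1 \<longrightarrow> (\<exists>u. norm u \<le> 1 / \<rho> + M * \<rho> ^ 2 \<and>
        \<psi> z / z = fps_nth A 1 + (u + of_real \<rho> ^ 2 * fps_nth A 2 * cnj u)))"
proof -
  obtain M \<delta>0 where \<delta>0: "\<delta>0 > 0" and M: "M \<ge> 0" "\<And>z. norm z < \<delta>0 \<Longrightarrow>
      norm (\<psi> z - (1 + fps_nth A 1 * z + fps_nth A 2 * z ^ 2)) \<le> M * norm z ^ 3"
    using fps_taylor_remainder3[OF exp] unfolding A0 by metis
  define b where "b = fps_nth A 2"
  \<comment> \<open>The last two bounds make
    \<open>\<rho>^2 * norm b \<le> \<rho> * norm b \<le> 1 / 2\<close>, which keeps the ellipse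
    uniformly away from degenerating.\<close>
  define \<delta> where "\<delta> = min \<delta>0 (min 1 (1 / (2 * (norm b + 1))))"
  have \<psi>0: "\<psi> 0 \<noteq> 0"
    using has_fps_expansion_imp_0_eq_fps_nth_0[OF exp] A0 by simp
  show ?thesis
  proof (rule that[of \<delta> "2 * M"])
    show "\<delta> > 0" using \<delta>0 by (auto simp: \<delta>_def add_nonneg_pos)
    show "0 \<le> 2 * M" using M by simp
    fix \<rho> :: real assume \<rho>: "0 < \<rho>" "\<rho> < \<delta>"
    then have \<rho>': "\<rho> < \<delta>0" "\<rho> < 1" "\<rho> < 1 / (2 * (norm b + 1))" by (auto simp: \<delta>_def)
    define k where "k = of_real \<rho> ^ 2 * b"
    have "norm k = \<rho> * (\<rho> * norm b)" using \<rho> by (simp add: k_def norm_mult norm_power power2_eq_square)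
    also have "\<dots> \<le> 1 * (\<rho> * norm b)" using \<rho> \<rho>' by (intro mult_right_mono) auto
    also have "\<dots> \<le> 1 / (2 * (norm b + 1)) * norm b" using \<rho>' by (simp only: mult_1) (intro mult_right_mono, auto)
    also have "\<dots> \<le> 1 / 2" proof -
      have pos: "0 < 2 * (norm b + 1)" by (simp add: add_nonneg_pos)
      have "norm b / (2 * (norm b + 1)) \<le> 1 / 2" unfolding pos_divide_le_eq[OF pos] by simp
      then show ?thesis by simp
    qed
    finally have k: "norm k \<le> 1 / 2" .
    define L where "L = (\<lambda>u. fps_nth A 1 + (u + k * cnj u))"
    define R where "R = 1 / \<rho> + 2 * M * \<rho> ^ 2"
    have "compact (L ` cball 0 R)" unfolding L_def
      by (intro compact_continuous_image continuous_intros) auto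
    moreover have "convex (L ` cball 0 R)"
    proof -
      have "linear (\<lambda>u. u + k * cnj u)"
        by (rule linearI) (auto simp: algebra_simps)
      then have "convex ((+) (fps_nth A 1) ` (\<lambda>u. u + k * cnj u) ` cball 0 R)"
        by (intro convex_translation convex_linear_image) auto
      then show ?thesis by (simp add: L_def image_image)
    qed
    moreover have "\<psi> z / z \<in> L ` cball 0 R" if z: "norm z = \<rho>" for z
    proof -
      have "z \<noteq> 0" using z \<rho> by auto
      define e where "e = (\<psi> z - (1 + fps_nth A 1 * z + b * z ^ 2)) / z"
      have "norm e \<le> M * norm z ^ 3 / norm z"
        unfolding e_def norm_divide b_def using z \<rho>' by (intro divide_right_mono M(2)) auto
      also have "\<dots> = M * \<rho> ^ 2" using z \<rho> by (simp add: power2_eq_square power3_eq_cube)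
      finally have e: "norm e \<le> M * \<rho> ^ 2" .
      \<comment> \<open>This solves \<open>u' + k * cnj u' = e\<close>, so that the Taylor error is
        absorbed into the parameter \<open>u\<close> of the ellipse. Inverting the map costs at most
        the factor \<open>1 / (1 - norm k) \<le> 2\<close>, hence the constant
        \<open>2 * M\<close>.\<close>
      define u' where "u' = (e - k * cnj e) / (1 - k * cnj k)"
      have k2: "(norm k)\<^sup>2 \<le> (1/2)\<^sup>2" using k by (intro power_mono) auto
      have nk: "norm (1 - k * cnj k) = 1 - (norm k)\<^sup>2"
      proof -
        have "1 - k * cnj k = of_real (1 - (norm k)\<^sup>2)" using complex_norm_square[of k] by simp
        then show ?thesis using k2 by (simp only: norm_of_real) (simp add: power2_eq_square)
      qed
      have nk0: "1 - k * cnj k \<noteq> 0" using nk k2 by (auto simp: power2_eq_square)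
      have "cnj (1 - k * cnj k) = 1 - k * cnj k" by (simp add: mult.commute)
      then have "u' + k * cnj u' = (e - k * cnj e + k * (cnj e - cnj k * e)) / (1 - k * cnj k)"
        by (simp add: u'_def add_divide_distrib)
      also have "\<dots> = e" using nk0 by (simp add: field_simps)
      finally have Lu': "u' + k * cnj u' = e" .
      have "norm u' = norm (e - k * cnj e) / (1 - (norm k)\<^sup>2)"
        by (simp add: u'_def norm_divide nk)
      also have "\<dots> \<le> (norm e * (1 + norm k)) / (1 - (norm k)\<^sup>2)"
      proof (intro divide_right_mono)
        have "norm (e - k * cnj e) \<le> norm e + norm (k * cnj e)" by (rule norm_triangle_ineq4)
        then show "norm (e - k * cnj e) \<le> norm e * (1 + norm k)"
          by (simp add: norm_mult algebra_simps)
        show "0 \<le> 1 - (norm k)\<^sup>2" using k2 by (simp add: power2_eq_square)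
      qed
      also have "1 - (norm k)\<^sup>2 = (1 - norm k) * (1 + norm k)" by (simp add: algebra_simps power2_eq_square)
      also have "norm e * (1 + norm k) / ((1 - norm k) * (1 + norm k)) = norm e / (1 - norm k)"
        using norm_ge_zero[of k] by (simp add: add_nonneg_eq_0_iff)
      also have "\<dots> \<le> norm e / (1/2)" using k by (intro divide_left_mono) auto
      finally have u': "norm u' \<le> 2 * M * \<rho> ^ 2" using e by simp
      have "norm (1 / z + u') \<le> 1 / \<rho> + norm u'"
        using norm_triangle_ineq[of "1 / z" u'] z by (simp add: norm_divide)
      then have "1 / z + u' \<in> cball 0 R" using u' by (simp add: R_def)
      moreover have "\<psi> z / z = L (1 / z + u')"
      proof -
        have "k * cnj (1 / z) = b * z"
        proof -
          have "of_real \<rho> ^ 2 = z * cnj z" using complex_norm_square[of z] z by simp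
          then show ?thesis using \<open>z \<noteq> 0\<close> by (simp add: k_def)
        qed
        then have "L (1 / z + u') = fps_nth A 1 + 1 / z + b * z + (u' + k * cnj u')"
          by (simp add: L_def algebra_simps)
        also have "\<dots> = \<psi> z / z" unfolding Lu' e_def using \<open>z \<noteq> 0\<close>
          by (simp add: field_simps power2_eq_square)
        finally show ?thesis ..
      qed
      ultimately show ?thesis by blast
    qed
    ultimately have "\<psi> z / z \<in> L ` cball 0 R" if "\<rho> < norm z" "norm z < 1" for z
      using laurent_image_subset_of_circle[OF holo \<psi>0 inj \<rho>(1) \<rho>'(2)] that by blast
    then show "norm (of_real \<rho> ^ 2 * fps_nth A 2) \<le> 1 \<and>
      (\<forall>z. \<rho> < norm z \<longrightarrow> norm z < 1 \<longrightarrow> (\<exists>u. norm u \<le> 1 / \<rho> + 2 * M * \<rho> ^ 2 \<and>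
        \<psi> z / z = fps_nth A 1 + (u + of_real \<rho> ^ 2 * fps_nth A 2 * cnj u)))"
      using k unfolding k_def[symmetric] b_def[symmetric] by (fastforce simp: L_def R_def)
  qed
qed

section \<open>Gronwall's area theorem\<close>

lemma complex_exp_Complex: "exp (Complex x y) = of_real (exp x) * cis y"
  using exp_eq_polar[of "Complex x y"] by simp

text \<open>The substitution \<open>z = exp w\<close> turns the annulus into a rectangle, so that Fubini replaces polar coordinates.\<close>
lemma laurent_area_annulus:
  fixes \<psi> :: "complex \<Rightarrow> complex"
  assumes holo: "\<psi> holomorphic_on unit_disc" and exp: "\<psi> has_fps_expansion A" and A0: "fps_nth A 0 = 1"
    and inj: "inj_on (\<lambda>z. \<psi> z / z) (unit_disc - {0})"
    and \<rho>r: "0 < \<rho>" "\<rho> < r" "r < 1"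
    and k: "norm k \<le> 1" and R: "R \<ge> 0"
    and image: "\<And>z. \<rho> < norm z \<Longrightarrow> norm z < 1 \<Longrightarrow> \<exists>u. norm u \<le> R \<and> \<psi> z / z = w0 + (u + k * cnj u)"
  shows "1 / \<rho>\<^sup>2 - 1 / r\<^sup>2 + (\<Sum>n=2..N. real (n - 1) * (norm (fps_nth A n))\<^sup>2 * (r ^ (2 * (n - 1)) - \<rho> ^ (2 * (n - 1)))) \<le> R\<^sup>2"
proof -
  define a where "a = ln \<rho>"
  define b where "b = ln r"
  have ab: "a < b" "b < 0" "exp a = \<rho>" "exp b = r" using \<rho>r by (auto simp: a_def b_def)
  \<comment> \<open>Up to the factor \<open>z^2\<close> this is the derivative of
    \<open>\<psi> z / z\<close>. With \<open>z = exp w\<close> the chain rule turns it into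
    \<open>\<Phi>'\<close>, and the \<open>n\<close>-th Taylor coefficient picks up the factor
    \<open>n - 1\<close>.\<close>
  define \<theta> where "\<theta> = (\<lambda>z. z * deriv \<psi> z - \<psi> z)"
  have \<theta>_holo: "\<theta> holomorphic_on unit_disc"
    unfolding \<theta>_def by (intro holomorphic_intros holo) auto
  define B where "B = fps_X * fps_deriv A - A"
  have \<theta>_exp: "\<theta> has_fps_expansion B"
    unfolding \<theta>_def B_def by (intro fps_expansion_intros exp)
  have B_nth: "fps_nth B n = (of_nat n - 1) * fps_nth A n" for n
    by (cases n) (auto simp: B_def algebra_simps)
  define \<Phi> where "\<Phi> = (\<lambda>w. \<psi> (exp w) * exp (- w))"
  define \<Phi>' where "\<Phi>' = (\<lambda>w. \<theta> (exp w) * exp (- w))"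
  have in_disc: "exp w \<in> unit_disc" if "Re w < 0" for w :: complex
    using that by simp
  have der: "(\<Phi> has_field_derivative \<Phi>' w) (at w)" if "Re w < 0" for w
  proof -
    have "(\<psi> has_field_derivative deriv \<psi> (exp w)) (at (exp w))"
      by (rule holomorphic_derivI[OF holo]) (use in_disc[OF that] in auto)
    from DERIV_mult[OF DERIV_chain2[OF this DERIV_exp] DERIV_chain2[OF DERIV_exp DERIV_minus[OF DERIV_ident]]]
    show ?thesis
      by (simp add: \<Phi>_def \<Phi>'_def \<theta>_def algebra_simps)
  qed
  have cont: "continuous_on {w. Re w < 0} \<Phi>'"
    unfolding \<Phi>'_def
    by (intro continuous_intros continuous_on_compose2[OF holomorphic_on_imp_continuous_on[OF \<theta>_holo]])
       (use in_disc in auto)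
  have \<Phi>_eq: "\<Phi> w = \<psi> (exp w) / exp w" for w by (simp add: \<Phi>_def exp_minus field_simps)
  let ?I = "\<lambda>x. integral {0..2 * pi} (\<lambda>y. (norm (\<Phi>' (Complex x y)))\<^sup>2)"
  have upper: "integral {a..b} ?I \<le> pi * R\<^sup>2"
  proof (rule integral_norm_deriv_le_ellipse[where \<Phi> = \<Phi>, OF _ _ _ _ k R])
    show "(\<Phi> has_field_derivative \<Phi>' z) (at z)"
      if "z \<in> {z. a \<le> Re z \<and> Re z \<le> b \<and> 0 \<le> Im z \<and> Im z \<le> 2 * pi}" for z
      using that ab by (intro der) auto
    show "continuous_on {z. a \<le> Re z \<and> Re z \<le> b \<and> 0 \<le> Im z \<and> Im z \<le> 2 * pi} \<Phi>'"
      by (rule continuous_on_subset[OF cont]) (use ab in auto)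
    \<comment> \<open>In the open strip of height \<open>2 * pi\<close> imaginary parts differ by
      less than a period, so \<open>exp\<close> is injective there.\<close>
    show "inj_on \<Phi> {z. a < Re z \<and> Re z < b \<and> 0 < Im z \<and> Im z < 2 * pi}"
    proof (rule inj_onI)
      fix z w assume zw: "z \<in> {z. a < Re z \<and> Re z < b \<and> 0 < Im z \<and> Im z < 2 * pi}"
        "w \<in> {z. a < Re z \<and> Re z < b \<and> 0 < Im z \<and> Im z < 2 * pi}" "\<Phi> z = \<Phi> w"
      have "exp z = exp w"
        by (rule inj_onD[OF inj]) (use zw ab in_disc[of z] in_disc[of w] in \<open>auto simp: \<Phi>_eq\<close>)
      then show "z = w" by (rule exp_complex_eqI[rotated]) (use zw in auto)
    qed
    show "\<exists>u. norm u \<le> R \<and> \<Phi> z = w0 + (u + k * cnj u)" if "a < Re z" "Re z < b" for z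
    proof -
      have "\<rho> < exp (Re z)" using that(1) ab(3) by (metis exp_less_cancel_iff)
      then show ?thesis unfolding \<Phi>_eq using that ab by (intro image) auto
    qed
  qed
  \<comment> \<open>On \<open>Re w = x\<close>, \<open>e n x\<close> is the squared modulus of
    \<open>z ^ n / z\<close> for \<open>z = exp w\<close>. The exponent is real, so
    \<open>n = 0\<close> gives the pole term \<open>exp (-2 * x)\<close>. \<open>l\<close> is the
    Bessel lower bound for the inner integral, and \<open>L\<close> its antiderivative.\<close>
  define e where "e = (\<lambda>n x. exp ((2 * real n - 2) * x))"
  define l where "l = (\<lambda>x. 2 * pi * (e 0 x + (\<Sum>n=2..N. (real n - 1)\<^sup>2 * (norm (fps_nth A n))\<^sup>2 * e n x)))"
  define L where "L = (\<lambda>x. pi * (- e 0 x + (\<Sum>n=2..N. (real n - 1) * (norm (fps_nth A n))\<^sup>2 * e n x)))"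
  \<comment> \<open>Bessel's inequality for \<open>\<theta>\<close> on the circle of radius
    \<open>exp x\<close>. The index 1 is missing from \<open>l\<close> because the first coefficient
    of \<open>\<theta>\<close> vanishes.\<close>
  have l_le: "l x \<le> ?I x" if "x < 0" for x
  proof -
    have norm_\<Phi>': "(norm (\<Phi>' (Complex x y)))\<^sup>2 = e 0 x * (norm (\<theta> (of_real (exp x) * cis y)))\<^sup>2" for y
      by (simp add: \<Phi>'_def complex_exp_Complex norm_mult power_mult_distrib e_def flip: exp_double)
    have e_n: "e 0 x * exp x ^ (2 * n) = e n x" for n
      by (simp add: e_def exp_of_nat_mult[symmetric] exp_add[symmetric] algebra_simps)
    have "e 0 x + (\<Sum>n=2..N. (real n - 1)\<^sup>2 * (norm (fps_nth A n))\<^sup>2 * e n x) =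
        (\<Sum>n\<in>insert 0 {2..N}. (norm (fps_nth B n))\<^sup>2 * e n x)"
    proof -
      have "norm (of_nat n - 1 :: complex) = \<bar>real n - 1\<bar>" for n
        using norm_of_real[of "real n - 1", where 'a = complex] by simp
      then show ?thesis by (simp add: B_nth norm_mult power_mult_distrib A0)
    qed
    also have "\<dots> \<le> (\<Sum>n\<le>max N 2. (norm (fps_nth B n))\<^sup>2 * e n x)"
      by (rule sum_mono2) (auto simp: e_def)
    also have "\<dots> = e 0 x * (\<Sum>n\<le>max N 2. (norm (fps_nth B n))\<^sup>2 * exp x ^ (2 * n))"
    proof -
      have "e 0 x * (c * exp x ^ (2 * n)) = c * e n x" for c n
        using e_n[of n] by (metis mult.left_commute)
      then show ?thesis by (simp only: sum_distrib_left)
    qed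
    finally have "l x \<le> e 0 x * (2 * pi * (\<Sum>n\<le>max N 2. (norm (fps_nth B n))\<^sup>2 * exp x ^ (2 * n)))"
      unfolding l_def using pi_gt_zero by (simp add: mult_ac)
    also have "\<dots> \<le> e 0 x * integral {0..2 * pi} (\<lambda>y. (norm (\<theta> (of_real (exp x) * cis y)))\<^sup>2)"
      by (intro mult_left_mono bessel_circle[OF \<theta>_holo \<theta>_exp]) (use that in \<open>auto simp: e_def\<close>)
    also have "\<dots> = ?I x" by (simp add: norm_\<Phi>')
    finally show ?thesis .
  qed
  have int_l: "(l has_integral (L b - L a)) {a..b}"
  proof (rule fundamental_theorem_of_calculus)
    show "a \<le> b" using ab by simp
    have de: "(e n has_real_derivative (2 * real n - 2) * e n x) (at x within S)" for n x S
      unfolding e_def by (auto intro!: derivative_eq_intros)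
    have "(L has_real_derivative pi * (- ((2 * real 0 - 2) * e 0 x) +
        (\<Sum>n=2..N. (real n - 1) * (norm (fps_nth A n))\<^sup>2 * ((2 * real n - 2) * e n x)))) (at x within S)" for x S
      unfolding L_def by (intro DERIV_cmult DERIV_add DERIV_minus DERIV_sum de)
    moreover have "pi * (- ((2 * real 0 - 2) * e 0 x) +
        (\<Sum>n=2..N. (real n - 1) * (norm (fps_nth A n))\<^sup>2 * ((2 * real n - 2) * e n x))) = l x" for x
      by (simp add: l_def sum_distrib_left algebra_simps power2_eq_square)
    ultimately show "(L has_vector_derivative l x) (at x within {a..b})" for x
      by (simp add: has_real_derivative_iff_has_vector_derivative)
  qed
  have "?I integrable_on {a..b}"
  proof (rule integrable_continuous_interval)
    have "continuous_on ({a..b} \<times> cbox 0 (2 * pi)) (\<lambda>(x, y). (norm (\<Phi>' (Complex x y)))\<^sup>2)"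
      unfolding case_prod_unfold Complex_eq
      by (intro continuous_intros continuous_on_compose2[OF cont]) (use ab in auto)
    then show "continuous_on {a..b} ?I"
      using integral_continuous_on_param[of "{a..b}" 0 "2 * pi" "\<lambda>x y. (norm (\<Phi>' (Complex x y)))\<^sup>2"] by simp
  qed
  then have "integral {a..b} l \<le> integral {a..b} ?I"
    using int_l l_le ab by (intro integral_le) (auto simp: has_integral_iff)
  with upper have "L b - L a \<le> pi * R\<^sup>2" using int_l by (simp add: has_integral_iff)
  moreover have "L x = pi * (- (1 / (exp x)\<^sup>2) + (\<Sum>n=2..N. real (n - 1) * (norm (fps_nth A n))\<^sup>2 * exp x ^ (2 * (n - 1))))" for x
  proof -
    have "e n x = exp x ^ (2 * (n - 1))" if "n \<ge> 2" for n
      using that by (simp add: e_def exp_of_nat_mult[symmetric] of_nat_diff algebra_simps)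
    moreover have "e 0 x = 1 / (exp x)\<^sup>2"
      by (simp add: e_def exp_minus exp_double[symmetric] field_simps)
    ultimately show ?thesis
      unfolding L_def by (intro arg_cong2[where f = "(*)"] arg_cong2[where f = "(+)"] refl sum.cong) (auto simp: of_nat_diff)
  qed
  moreover define S where
    "S = (\<lambda>x::real. \<Sum>n=2..N. real (n - 1) * (norm (fps_nth A n))\<^sup>2 * x ^ (2 * (n - 1)))"
  ultimately have "pi * (- (1 / r\<^sup>2) + S r) - pi * (- (1 / \<rho>\<^sup>2) + S \<rho>) \<le> pi * R\<^sup>2"
    using ab by simp
  then have "pi * (1 / \<rho>\<^sup>2 - 1 / r\<^sup>2 + (S r - S \<rho>)) \<le> pi * R\<^sup>2"
    by (simp add: algebra_simps)
  then have "1 / \<rho>\<^sup>2 - 1 / r\<^sup>2 + (S r - S \<rho>) \<le> R\<^sup>2" using pi_gt_zero by simp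
  then show ?thesis by (simp only: S_def right_diff_distrib sum_subtractf)
qed

text \<open>The area of the image of an annulus is bounded by that of the enclosing ellipse. Both
  bounds contain the divergent term \<open>1 / \<rho>^2\<close>, which cancels exactly; then the
  inner radius tends to 0 and the outer one to 1.\<close>

theorem gronwall_area:
  fixes \<psi> :: "complex \<Rightarrow> complex"
  assumes holo: "\<psi> holomorphic_on unit_disc" and exp: "\<psi> has_fps_expansion A" and A0: "fps_nth A 0 = 1"
    and inj: "inj_on (\<lambda>z. \<psi> z / z) (unit_disc - {0})"
  shows "(\<Sum>n=2..N. real (n - 1) * (norm (fps_nth A n))\<^sup>2) \<le> 1"
proof -
  obtain M \<delta> where \<delta>: "\<delta> > 0" and M: "M \<ge> 0" and ell:
    "\<And>\<rho>. 0 < \<rho> \<Longrightarrow> \<rho> < \<delta> \<Longrightarrow> norm (of_real \<rho> ^ 2 * fps_nth A 2) \<le> 1 \<and>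
      (\<forall>z. \<rho> < norm z \<longrightarrow> norm z < 1 \<longrightarrow> (\<exists>u. norm u \<le> 1 / \<rho> + M * \<rho> ^ 2 \<and>
        \<psi> z / z = fps_nth A 1 + (u + of_real \<rho> ^ 2 * fps_nth A 2 * cnj u)))"
    using laurent_image_subset_ellipse[OF assms] by metis
  let ?S = "\<lambda>\<rho> r. \<Sum>n=2..N. real (n - 1) * (norm (fps_nth A n))\<^sup>2 * (r ^ (2 * (n - 1)) - \<rho> ^ (2 * (n - 1)))"
  \<comment> \<open>First \<open>\<rho>\<close> tends to 0 with \<open>r\<close> fixed. Squaring
    \<open>1 / \<rho> + M * \<rho>^2\<close> leaves, beyond \<open>1 / \<rho>^2\<close>, only terms
    that vanish in the limit.\<close>
  have *: "?S 0 r \<le> 1 / r\<^sup>2" if r: "0 < r" "r < 1" for r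
  proof (rule tendsto_le[OF trivial_limit_at_right_real[of 0]])
    have "((\<lambda>\<rho>. 1 / r\<^sup>2 + 2 * M * \<rho> + M\<^sup>2 * \<rho> ^ 4) \<longlongrightarrow> 1 / r\<^sup>2 + 2 * M * 0 + M\<^sup>2 * 0 ^ 4) (at_right 0)"
      by (intro tendsto_intros)
    then show "((\<lambda>\<rho>. 1 / r\<^sup>2 + 2 * M * \<rho> + M\<^sup>2 * \<rho> ^ 4) \<longlongrightarrow> 1 / r\<^sup>2) (at_right 0)" by simp
    show "((\<lambda>\<rho>. ?S \<rho> r) \<longlongrightarrow> ?S 0 r) (at_right 0)"
      by (intro tendsto_intros)
    have "eventually (\<lambda>\<rho>. \<rho> \<in> {0<..<min \<delta> r}) (at_right 0)"
      by (rule eventually_at_right_real) (use \<delta> r in auto)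
    then show "eventually (\<lambda>\<rho>. ?S \<rho> r \<le> 1 / r\<^sup>2 + 2 * M * \<rho> + M\<^sup>2 * \<rho> ^ 4) (at_right 0)"
    proof eventually_elim
      case (elim \<rho>)
      then have \<rho>: "0 < \<rho>" "\<rho> < \<delta>" "\<rho> < r" by auto
      have "1 / \<rho>\<^sup>2 - 1 / r\<^sup>2 + ?S \<rho> r \<le> (1 / \<rho> + M * \<rho> ^ 2)\<^sup>2"
        by (rule laurent_area_annulus[OF holo exp A0 inj \<rho>(1,3) r(2)]) (use ell[OF \<rho>(1,2)] \<rho> M in auto)
      also have "\<dots> = 1 / \<rho>\<^sup>2 + 2 * M * \<rho> + M\<^sup>2 * \<rho> ^ 4"
        using \<rho> by (simp add: field_simps power2_eq_square power4_eq_xxxx)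
      finally show ?case by simp
    qed
  qed
  have "?S 0 1 \<le> 1 / 1\<^sup>2"
  proof (rule tendsto_le[OF trivial_limit_at_left_real[of 1]])
    show "((\<lambda>r::real. 1 / r\<^sup>2) \<longlongrightarrow> 1 / 1\<^sup>2) (at_left 1)"
      by (intro tendsto_intros) auto
    show "((\<lambda>r. ?S 0 r) \<longlongrightarrow> ?S 0 1) (at_left 1)"
      by (intro tendsto_intros)
    have "eventually (\<lambda>r::real. r \<in> {0<..<1}) (at_left 1)"
      by (rule eventually_at_left_real) auto
    then show "eventually (\<lambda>r. ?S 0 r \<le> 1 / r\<^sup>2) (at_left 1)"
      by eventually_elim (use * in auto)
  qed
  \<comment> \<open>For \<open>n \<ge> 2\<close> the exponent \<open>2 * (n - 1)\<close> is
    positive, so the power of 0 drops out.\<close>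
  moreover have "?S 0 1 = (\<Sum>n=2..N. real (n - 1) * (norm (fps_nth A n))\<^sup>2)"
    by (intro sum.cong refl) (auto simp: power_0_left)
  ultimately show ?thesis by simp
qed

section \<open>Coefficients of univalent and bi-univalent functions\<close>

lemma class_S_taylor_coeff:
  assumes "f \<in> class_S"
  shows "f has_fps_expansion fps_expansion f 0" "taylor_coeff f 0 = 0" "taylor_coeff f 1 = 1"
proof -
  show *: "f has_fps_expansion fps_expansion f 0"
    using assms by (intro has_fps_expansion_fps_expansion[of unit_disc]) (auto simp: class_S_def)
  show "taylor_coeff f 0 = 0" "taylor_coeff f 1 = 1"
    using assms unfolding fps_nth_fps_expansion[OF *] by (auto simp: class_S_def)
qed

text \<open>\<open>\<psi>\<close> is \<open>z / f z\<close> with the singularity at 0 removed: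
  \<open>f z / z\<close> takes the value 1 at 0 and has no other zero in the disc, as
  \<open>f\<close> is injective and \<open>f 0 = 0\<close>. This brings \<open>1 / f\<close> into
  the form \<open>\<psi> z / z\<close> of the area theorem. The coefficients result from multiplying
  \<open>A\<close> with the series of \<open>f z / z\<close>.\<close>

lemma class_S_reciprocal:
  assumes f: "f \<in> class_S"
  obtains \<psi> A where "\<psi> holomorphic_on unit_disc" "\<psi> has_fps_expansion A"
    "fps_nth A 0 = 1" "fps_nth A 1 = - taylor_coeff f 2"
    "fps_nth A 2 = (taylor_coeff f 2)\<^sup>2 - taylor_coeff f 3"
    "fps_nth A 3 = - taylor_coeff f 4 + 2 * taylor_coeff f 2 * taylor_coeff f 3 - taylor_coeff f 2 ^ 3"
    "\<And>z. z \<in> unit_disc \<Longrightarrow> \<psi> z \<noteq> 0" "\<And>z. z \<noteq> 0 \<Longrightarrow> \<psi> z / z = 1 / f z"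
proof -
  define F where "F = fps_expansion f 0"
  have F: "f has_fps_expansion F" "fps_nth F 0 = 0" "fps_nth F 1 = 1"
    using class_S_taylor_coeff[OF f] by (auto simp: F_def)
  have holo: "f holomorphic_on unit_disc" and inj: "inj_on f unit_disc" and f0: "f 0 = 0"
    using f by (auto simp: class_S_def)
  define \<phi> where "\<phi> = (\<lambda>z. if z = 0 then 1 else f z / z ^ 1)"
  have "F \<noteq> 0" using F(3) by auto
  then have deg: "1 \<le> subdegree F" using F(2) by (intro subdegree_geI) auto
  have \<phi>_exp: "\<phi> has_fps_expansion fps_shift 1 F"
    unfolding \<phi>_def by (rule has_fps_expansion_shift[OF F(1) deg]) (use F(3) in simp)
  have \<phi>_nz: "\<phi> z \<noteq> 0" if "z \<in> unit_disc" for z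
    using inj_onD[OF inj, of z 0] that f0 by (auto simp: \<phi>_def)
  have "\<phi> holomorphic_on unit_disc"
  proof -
    have "(\<lambda>z. f z / z ^ 1) holomorphic_on unit_disc - {0}"
      by (intro holomorphic_intros holomorphic_on_subset[OF holo]) auto
    then have "\<phi> holomorphic_on unit_disc - {0}"
      by (rule holomorphic_transform) (auto simp: \<phi>_def)
    then have "\<phi> analytic_on unit_disc - {0}"
      by (subst analytic_on_open) auto
    \<comment> \<open>The quotient is holomorphic away from 0 only; at 0 the shifted power series
      supplies analyticity.\<close>
    moreover have "\<phi> analytic_on {0}"
      using \<phi>_exp by (rule has_fps_expansion_imp_analytic_0)
    ultimately have "\<phi> analytic_on (unit_disc - {0}) \<union> {0}"
      by (simp only: analytic_on_Un)
    then show ?thesis by (auto intro: analytic_imp_holomorphic analytic_on_subset)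
  qed
  define A where "A = inverse (fps_shift 1 F)"
  have A_mult: "A * fps_shift 1 F = 1"
    unfolding A_def by (rule inverse_mult_eq_1) (use F(3) in simp)
  have nth: "fps_nth (A * fps_shift 1 F) n = fps_nth 1 n" for n by (simp only: A_mult)
  have A0: "fps_nth A 0 = 1"
    using nth[of 0] F(3) by simp
  have A1: "fps_nth A 1 = - fps_nth F 2"
    using nth[of 1] F(3) A0 by (simp add: fps_mult_nth numeral_2_eq_2 add_eq_0_iff)
  have A2: "fps_nth A 2 = (fps_nth F 2)\<^sup>2 - fps_nth F 3"
    using nth[of 2] F(3) A0 A1
    by (simp add: fps_mult_nth numeral_2_eq_2 numeral_3_eq_3 power2_eq_square algebra_simps add_eq_0_iff)
  have A3: "fps_nth A 3 = - fps_nth F 4 + 2 * fps_nth F 2 * fps_nth F 3 - fps_nth F 2 ^ 3"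
  proof -
    have "fps_nth A 3 + (fps_nth A 2 * fps_nth F 2 + fps_nth A 1 * fps_nth F 3 + fps_nth F 4) = 0"
      using nth[of 3] F(3) A0 by (simp add: fps_mult_nth eval_nat_numeral algebra_simps)
    then have "fps_nth A 3 = - (fps_nth A 2 * fps_nth F 2 + fps_nth A 1 * fps_nth F 3 + fps_nth F 4)"
      by (simp only: eq_neg_iff_add_eq_0)
    then show ?thesis unfolding A1 A2 by (simp add: algebra_simps power2_eq_square power3_eq_cube)
  qed
  show ?thesis
  proof (rule that[of "\<lambda>z. inverse (\<phi> z)" A])
    show "(\<lambda>z. inverse (\<phi> z)) holomorphic_on unit_disc"
      using \<phi>_nz by (intro holomorphic_intros \<open>\<phi> holomorphic_on unit_disc\<close>) auto
    show "(\<lambda>z. inverse (\<phi> z)) has_fps_expansion A"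
      unfolding A_def by (rule has_fps_expansion_inverse[OF \<phi>_exp]) (use F(3) in simp)
    show "inverse (\<phi> z) \<noteq> 0" if "z \<in> unit_disc" for z using \<phi>_nz[OF that] by simp
    show "inverse (\<phi> z) / z = 1 / f z" if "z \<noteq> 0" for z using that by (simp add: \<phi>_def)
  qed (use A0 A1 A2 A3 in \<open>simp_all add: F_def\<close>)
qed

text \<open>The function \<open>1 / f\<close> inherits injectivity from \<open>f\<close>; the terms
  \<open>n = 2\<close> and \<open>n = 3\<close> of the area theorem carry the weights 1 and
  2.\<close>

lemma class_S_area:
  assumes f: "f \<in> class_S"
  shows "(norm ((taylor_coeff f 2)\<^sup>2 - taylor_coeff f 3))\<^sup>2 +
    2 * (norm (- taylor_coeff f 4 + 2 * taylor_coeff f 2 * taylor_coeff f 3 - taylor_coeff f 2 ^ 3))\<^sup>2 \<le> 1"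
proof -
  from class_S_reciprocal[OF f] obtain \<psi> A where \<psi>: "\<psi> holomorphic_on unit_disc" "\<psi> has_fps_expansion A"
    "fps_nth A 0 = 1"
    and A: "fps_nth A 2 = (taylor_coeff f 2)\<^sup>2 - taylor_coeff f 3"
    "fps_nth A 3 = - taylor_coeff f 4 + 2 * taylor_coeff f 2 * taylor_coeff f 3 - taylor_coeff f 2 ^ 3"
    and eq: "\<And>z. z \<noteq> 0 \<Longrightarrow> \<psi> z / z = 1 / f z" by metis
  have inj: "inj_on f unit_disc" using f by (simp add: class_S_def)
  have "inj_on (\<lambda>z. \<psi> z / z) (unit_disc - {0})"
  proof (rule inj_onI)
    fix z w assume zw: "z \<in> unit_disc - {0}" "w \<in> unit_disc - {0}" "\<psi> z / z = \<psi> w / w"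
    then have "1 / f z = 1 / f w" using eq[of z] eq[of w] by simp
    then have "f z = f w" by (metis div_by_1 divide_divide_eq_right mult_1)
    then show "z = w" by (rule inj_onD[OF inj]) (use zw in auto)
  qed
  from gronwall_area[OF \<psi> this, of 3]
  have "(\<Sum>n=2..3. real (n - 1) * (norm (fps_nth A n))\<^sup>2) \<le> 1" .
  moreover have "{2..3::nat} = {2, 3}" by auto
  ultimately show ?thesis by (simp add: A)
qed

text \<open>The area theorem for \<open>1 / sqrt (f (z\<^sup>2))\<close>, which is again injective on the punctured disc
  since \<open>f (z\<^sup>2)\<close> determines \<open>z\<close> up to sign and the square root is odd.\<close>
lemma class_S_odd_area:
  assumes f: "f \<in> class_S"
  shows "(norm (taylor_coeff f 2 / 2))\<^sup>2 +
    3 * (norm ((3 / 4 * (taylor_coeff f 2)\<^sup>2 - taylor_coeff f 3) / 2))\<^sup>2 \<le> 1"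
proof -
  from class_S_reciprocal[OF f] obtain \<psi> A where \<psi>: "\<psi> holomorphic_on unit_disc" "\<psi> has_fps_expansion A"
    "fps_nth A 0 = 1"
    and A: "fps_nth A 1 = - taylor_coeff f 2" "fps_nth A 2 = (taylor_coeff f 2)\<^sup>2 - taylor_coeff f 3"
    and nz: "\<And>z. z \<in> unit_disc \<Longrightarrow> \<psi> z \<noteq> 0"
    and eq: "\<And>z. z \<noteq> 0 \<Longrightarrow> \<psi> z / z = 1 / f z" by metis
  have inj: "inj_on f unit_disc" using f by (simp add: class_S_def)
  \<comment> \<open>A holomorphic square root exists because \<open>\<psi>\<close> has no zeros on
    the contractible disc.\<close>
  obtain \<kappa>0 where \<kappa>0: "\<kappa>0 holomorphic_on unit_disc" "\<And>z. z \<in> unit_disc \<Longrightarrow> \<psi> z = \<kappa>0 z ^ 2"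
    using contractible_imp_holomorphic_sqrt[OF \<psi>(1) convex_imp_contractible[OF convex_ball] nz] by metis
  have \<psi>0: "\<psi> 0 = 1" using has_fps_expansion_imp_0_eq_fps_nth_0[OF \<psi>(2)] \<psi>(3) by simp
  \<comment> \<open>Since \<open>\<kappa>0 0\<close> is 1 or -1, dividing by it selects the root
    with value 1 at 0 and leaves the square unchanged.\<close>
  define \<kappa> where "\<kappa> = (\<lambda>z. \<kappa>0 z / \<kappa>0 0)"
  have sq: "\<kappa>0 0 ^ 2 = 1" using \<kappa>0(2)[of 0] \<psi>0 by simp
  then have \<kappa>00: "\<kappa>0 0 \<noteq> 0" by auto
  have \<kappa>_holo: "\<kappa> holomorphic_on unit_disc" unfolding \<kappa>_def using \<kappa>00 by (intro holomorphic_intros \<kappa>0) auto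
  have \<kappa>_sq: "\<psi> z = \<kappa> z ^ 2" if "z \<in> unit_disc" for z
    using \<kappa>0(2)[OF that] sq by (simp add: \<kappa>_def power_divide)
  define B where "B = fps_expansion \<kappa> 0"
  have \<kappa>_exp: "\<kappa> has_fps_expansion B"
    unfolding B_def by (rule has_fps_expansion_fps_expansion[OF _ _ \<kappa>_holo]) auto
  have B0: "fps_nth B 0 = 1"
    using has_fps_expansion_imp_0_eq_fps_nth_0[OF \<kappa>_exp] \<kappa>00 by (simp add: \<kappa>_def)
  have "B * B = A"
  proof (rule fps_expansion_unique_complex[OF _ \<psi>(2)])
    have "eventually (\<lambda>z. z \<in> unit_disc) (nhds (0::complex))"
      by (intro eventually_nhds_in_open) auto
    then have "eventually (\<lambda>z. \<kappa> z * \<kappa> z = \<psi> z) (nhds 0)"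
      by eventually_elim (simp add: \<kappa>_sq power2_eq_square)
    from has_fps_expansion_cong[OF this refl] show "\<psi> has_fps_expansion B * B"
      using has_fps_expansion_mult[OF \<kappa>_exp \<kappa>_exp] by simp
  qed
  then have nth: "fps_nth (B * B) n = fps_nth A n" for n by simp
  have B1: "fps_nth B 1 = - taylor_coeff f 2 / 2"
  proof -
    have "2 * fps_nth B 1 = - taylor_coeff f 2"
      using nth[of 1] B0 A(1) by (simp add: fps_mult_nth)
    then show ?thesis by (metis nonzero_mult_div_cancel_left zero_neq_numeral)
  qed
  have B2: "fps_nth B 2 = (3 / 4 * (taylor_coeff f 2)\<^sup>2 - taylor_coeff f 3) / 2"
  proof -
    have "2 * fps_nth B 2 + (fps_nth B 1)\<^sup>2 = (taylor_coeff f 2)\<^sup>2 - taylor_coeff f 3"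
      using nth[of 2] B0 A(2) by (simp add: fps_mult_nth numeral_2_eq_2)
    then show ?thesis unfolding B1 by (simp add: power2_eq_square field_simps)
  qed
  define \<eta> where "\<eta> = \<kappa> \<circ> (\<lambda>z. z ^ 2)"
  define C where "C = fps_compose B (fps_X ^ 2)"
  have \<eta>_exp: "\<eta> has_fps_expansion C"
    unfolding \<eta>_def C_def by (intro has_fps_expansion_compose[OF \<kappa>_exp] fps_expansion_intros) auto
  have sq_disc: "z ^ 2 \<in> unit_disc" if "z \<in> unit_disc" for z :: complex
    using that by (simp add: norm_power power_less_one_iff)
  have \<eta>_holo: "\<eta> holomorphic_on unit_disc"
    unfolding \<eta>_def by (intro holomorphic_on_compose_gen[OF _ \<kappa>_holo] holomorphic_intros) (use sq_disc in auto)
  have C_nth: "fps_nth C n = (if even n then fps_nth B (n div 2) else 0)" for n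
    unfolding C_def by (rule fps_nth_compose_X_power)
  have \<eta>_sq: "(\<eta> z / z) ^ 2 = 1 / f (z ^ 2)" if "z \<in> unit_disc" "z \<noteq> 0" for z
    using \<kappa>_sq[OF sq_disc[OF that(1)]] eq[of "z ^ 2"] that by (simp add: \<eta>_def power_divide)
  have "inj_on (\<lambda>z. \<eta> z / z) (unit_disc - {0})"
  proof (rule inj_onI)
    fix z w assume zw: "z \<in> unit_disc - {0}" "w \<in> unit_disc - {0}" "\<eta> z / z = \<eta> w / w"
    then have "1 / f (z ^ 2) = 1 / f (w ^ 2)" using \<eta>_sq[of z] \<eta>_sq[of w] by simp
    then have "f (z ^ 2) = f (w ^ 2)" by (metis div_by_1 divide_divide_eq_right mult_1)
    then have "z ^ 2 = w ^ 2" by (rule inj_onD[OF inj]) (use zw sq_disc in auto)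
    then consider "z = w" | "z = - w" by (auto simp: power2_eq_iff)
    then show "z = w"
    proof cases
      \<comment> \<open>\<open>\<eta>\<close> is even, so equal values of the odd quotient at
        \<open>w\<close> and \<open>- w\<close> would force \<open>\<eta> w = 0\<close>; but its
        square is a value of the zero-free \<open>\<psi>\<close>.\<close>
      case 2
      then have "\<eta> z = \<eta> w" by (simp add: \<eta>_def)
      then have "\<eta> w = 0" using zw 2 by (auto simp: field_simps)
      then show ?thesis using nz[OF sq_disc, of w] \<kappa>_sq[OF sq_disc, of w] zw by (simp add: \<eta>_def)
    qed
  qed
  \<comment> \<open>The series of \<open>\<eta>\<close> has even powers only: the coefficients 1 and
    2 of \<open>B\<close> sit at the indices 2 and 4, with weights 1 and 3.\<close>
  then have "(\<Sum>n=2..4. real (n - 1) * (norm (fps_nth C n))\<^sup>2) \<le> 1"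
    by (intro gronwall_area[OF \<eta>_holo \<eta>_exp]) (simp_all add: C_nth B0)
  moreover have "{2..4::nat} = {2, 3, 4}" by auto
  ultimately have "(norm (fps_nth B 1))\<^sup>2 + 3 * (norm (fps_nth B 2))\<^sup>2 \<le> 1"
    by (simp add: C_nth)
  then show ?thesis unfolding B1 B2 by (simp add: norm_divide)
qed

text \<open>Near 0 the composition \<open>g \<circ> f\<close> is the identity. Comparing
  coefficients up to order 3 yields those of the inverse series and at the same time the
  normalization that puts the extension \<open>g\<close> into \<open>class_S\<close>.\<close>

lemma class_Sb_inverse:
  assumes "f \<in> class_Sb"
  obtains g where "g \<in> class_S" "taylor_coeff g 2 = - taylor_coeff f 2"
    "taylor_coeff g 3 = 2 * (taylor_coeff f 2)\<^sup>2 - taylor_coeff f 3"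
proof -
  from assms obtain g where f: "f \<in> class_S" and g: "g holomorphic_on unit_disc" "inj_on g unit_disc"
    and inv: "\<forall>\<^sub>F w in nhds 0. g w = the_inv_into unit_disc f w"
    unfolding class_Sb_def by blast
  have inj: "inj_on f unit_disc" and f0: "f 0 = 0" and holo: "f holomorphic_on unit_disc"
    using f by (auto simp: class_S_def)
  define F where "F = fps_expansion f 0"
  define G where "G = fps_expansion g 0"
  have F: "f has_fps_expansion F" "fps_nth F 0 = 0" "fps_nth F 1 = 1"
    using class_S_taylor_coeff[OF f] by (auto simp: F_def)
  have G: "g has_fps_expansion G"
    unfolding G_def by (rule has_fps_expansion_fps_expansion[OF _ _ g(1)]) auto
  have "isCont f 0" using holomorphic_on_imp_continuous_on[OF holo]
    by (simp add: continuous_on_eq_continuous_at)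
  \<comment> \<open>The inverse identity is known for \<open>w\<close> near 0; continuity of
    \<open>f\<close> with \<open>f 0 = 0\<close> allows substituting \<open>w = f z\<close>.\<close>
  then have "filterlim f (nhds 0) (nhds 0)" by (simp add: isCont_def f0 tendsto_nhds_iff)
  then have "eventually (\<lambda>z. g (f z) = the_inv_into unit_disc f (f z)) (nhds 0)"
    using inv by (rule eventually_compose_filterlim[rotated])
  moreover have "eventually (\<lambda>z. z \<in> unit_disc) (nhds (0::complex))"
    by (intro eventually_nhds_in_open) auto
  ultimately have gf: "eventually (\<lambda>z. (g \<circ> f) z = z) (nhds 0)"
    by eventually_elim (simp add: the_inv_into_f_f[OF inj])
  have GF: "fps_compose G F = fps_X"
  proof (rule fps_expansion_unique_complex)
    show "(g \<circ> f) has_fps_expansion fps_compose G F"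
      by (rule has_fps_expansion_compose[OF G F(1,2)])
    show "(g \<circ> f) has_fps_expansion fps_X"
      using has_fps_expansion_cong[OF gf refl] has_fps_expansion_fps_X by blast
  qed
  have nth: "(\<Sum>i=0..n. fps_nth G i * fps_nth (F ^ i) n) = fps_nth fps_X n" for n
    unfolding GF[symmetric] by (rule fps_compose_nth[symmetric])
  have G0: "fps_nth G 0 = 0" using nth[of 0] by simp
  have G1: "fps_nth G 1 = 1" using nth[of 1] G0 F by simp
  have G2: "fps_nth G 2 = - fps_nth F 2"
    using nth[of 2] G0 G1 F
    by (simp add: numeral_2_eq_2 power2_eq_square fps_mult_nth add_eq_0_iff)
  have G3: "fps_nth G 3 = 2 * (fps_nth F 2)\<^sup>2 - fps_nth F 3"
    using nth[of 3] G0 G1 G2 F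
    by (simp add: eval_nat_numeral fps_mult_nth algebra_simps add_eq_0_iff)
  have "g 0 = 0" using eventually_nhds_x_imp_x[OF gf] f0 by simp
  moreover have "deriv g 0 = 1" using fps_nth_fps_expansion[OF G, of 1] G1 by simp
  ultimately have "g \<in> class_S" using g by (simp add: class_S_def)
  then show ?thesis using G2 G3 by (intro that) (simp_all add: F_def G_def)
qed

text \<open>Passing to the inverse changes the sign of both \<open>a\<close> and \<open>p\<close>.
  The quantity \<open>p - a\<^sup>2\<close> in the bound for \<open>f\<close> thus becomes, up to
  sign, \<open>p + a\<^sup>2\<close> in the bound for \<open>g\<close>, and averaging the two bounds
  removes the cross term.\<close>

lemma class_Sb_odd_area:
  assumes "f \<in> class_Sb"
  shows "(norm (taylor_coeff f 2 / 2))\<^sup>2 + 3 / 4 * ((norm (taylor_coeff f 2 / 2))\<^sup>2)\<^sup>2 +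
    3 / 4 * (norm ((taylor_coeff f 2)\<^sup>2 - taylor_coeff f 3))\<^sup>2 \<le> 1"
proof -
  have f: "f \<in> class_S" using assms by (simp add: class_Sb_def)
  obtain g where g: "g \<in> class_S" "taylor_coeff g 2 = - taylor_coeff f 2"
    "taylor_coeff g 3 = 2 * (taylor_coeff f 2)\<^sup>2 - taylor_coeff f 3"
    by (rule class_Sb_inverse[OF assms])
  define a where "a = taylor_coeff f 2 / 2"
  define p where "p = (taylor_coeff f 2)\<^sup>2 - taylor_coeff f 3"
  have a2: "taylor_coeff f 2 = 2 * a" by (simp add: a_def)
  have a3: "taylor_coeff f 3 = 4 * a\<^sup>2 - p" by (simp add: p_def a2 power_mult_distrib)
  have 1: "(norm a)\<^sup>2 + 3 * (norm ((p - a\<^sup>2) / 2))\<^sup>2 \<le> 1"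
    using class_S_odd_area[OF f] unfolding a2 a3 by (simp add: power_mult_distrib)
  have "- ((p + a\<^sup>2) / 2) = (3 / 4 * (2 * a)\<^sup>2 - (2 * (2 * a)\<^sup>2 - (4 * a\<^sup>2 - p))) / 2"
    by (simp add: power_mult_distrib field_simps)
  then have 2: "(norm a)\<^sup>2 + 3 * (norm ((p + a\<^sup>2) / 2))\<^sup>2 \<le> 1"
    using class_S_odd_area[OF g(1)] unfolding g(2,3) a2 a3 power2_minus by (metis norm_minus_cancel minus_divide_left nonzero_mult_div_cancel_left zero_neq_numeral)
  have "(norm ((p - a\<^sup>2) / 2))\<^sup>2 + (norm ((p + a\<^sup>2) / 2))\<^sup>2 = ((norm p)\<^sup>2 + ((norm a)\<^sup>2)\<^sup>2) / 2"
  proof -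
    have "(norm (p - a\<^sup>2))\<^sup>2 + (norm (p + a\<^sup>2))\<^sup>2 = 2 * ((norm p)\<^sup>2 + (norm (a\<^sup>2))\<^sup>2)"
      unfolding cmod_power2 by (simp add: power2_eq_square algebra_simps)
    then show ?thesis by (simp add: norm_divide power_divide norm_power field_simps)
  qed
  with 1 2 show ?thesis unfolding a_def[symmetric] p_def[symmetric] by simp
qed

section \<open>The elementary inequality and the conclusion\<close>

lemma hankel_bound_aux:
  fixes t x y :: real
  assumes "t \<ge> 0" and 1: "x\<^sup>2 + 2 * y\<^sup>2 \<le> 1" and 2: "t\<^sup>2 + 3 / 4 * (t\<^sup>2)\<^sup>2 + 3 / 4 * x\<^sup>2 \<le> 1"
  shows "2 * t * y + x\<^sup>2 \<le> 1.28"
proof (cases "t\<^sup>2 \<le> 1 / 2")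
  case True
  \<comment> \<open>The weights are chosen so that \<open>2 * y\<^sup>2 + x\<^sup>2\<close> appears,
    which hypothesis \<open>1\<close> bounds by 1. The total is at most
    \<open>1 + 1 / 4\<close>.\<close>
  have "0 \<le> (t - 2 * y)\<^sup>2" by simp
  then have "2 * t * y \<le> t\<^sup>2 / 2 + 2 * y\<^sup>2" by (simp add: power2_eq_square algebra_simps)
  with 1 True show ?thesis by simp
next
  case False
  \<comment> \<open>For large \<open>t\<close> equal weights are better: hypothesis \<open>1\<close>
    eliminates \<open>y\<close> and half of \<open>x\<^sup>2\<close> remains, to be bounded by
    hypothesis \<open>2\<close>.\<close>
  have "0 \<le> (t - y)\<^sup>2" by simp
  then have "2 * t * y \<le> t\<^sup>2 + y\<^sup>2" by (simp add: power2_eq_square algebra_simps)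
  with 1 have *: "2 * t * y + x\<^sup>2 \<le> t\<^sup>2 + 1 / 2 + x\<^sup>2 / 2" by linarith
  define s where "s = t\<^sup>2"
  \<comment> \<open>The tangent of \<open>s\<^sup>2\<close> at \<open>1 / 2\<close> replaces the
    bound \<open>7/6 + s/3 - s\<^sup>2/2\<close> by the linear \<open>31/24 - s/6\<close>, which is
    below 1.21 for \<open>s > 1/2\<close>.\<close>
  have "0 \<le> (s - 1 / 2)\<^sup>2" by simp
  then have "s\<^sup>2 \<ge> s - 1 / 4" by (simp add: power2_eq_square algebra_simps)
  with 2 * False show ?thesis unfolding s_def[symmetric] by (simp add: field_simps)
qed

theorem theorem3:
  "\<exists>h::real. 1.280 \<le> h \<and> h < 1.281 \<and> (\<forall>f\<in>class_Sb. cmod (hankel_2_2 f) \<le> h)"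
\<comment> \<open>The elementary inequality reaches 1.28, so the left end of the interval already
  serves as \<open>h\<close>.\<close>
proof (intro exI[of _ "1.280"] conjI ballI)
  fix f assume f: "f \<in> class_Sb"
  define a where "a = taylor_coeff f 2"
  define p where "p = a\<^sup>2 - taylor_coeff f 3"
  define q where "q = - taylor_coeff f 4 + 2 * a * taylor_coeff f 3 - a ^ 3"
  have "f \<in> class_S" using f by (simp add: class_Sb_def)
  have "hankel_2_2 f = - (a * q + p\<^sup>2)"
    by (simp add: hankel_2_2_def a_def p_def q_def algebra_simps power2_eq_square power3_eq_cube)
  then have "cmod (hankel_2_2 f) \<le> norm (a * q) + norm (p\<^sup>2)"
    using norm_triangle_ineq[of "a * q" "p\<^sup>2"] by (simp only: norm_minus_cancel)
  also have "\<dots> = 2 * norm (a / 2) * norm q + (norm p)\<^sup>2"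
    by (simp add: norm_mult norm_divide norm_power)
  also have "\<dots> \<le> 1.28"
    by (rule hankel_bound_aux)
       (use class_S_area[OF \<open>f \<in> class_S\<close>] class_Sb_odd_area[OF f] in \<open>simp_all add: a_def p_def q_def\<close>)
  finally show "cmod (hankel_2_2 f) \<le> 1.280" by simp
qed simp_all

end
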